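(* Let $n, k$ be positive integers, let $x \in \mathbb{R}^n$, and let $n = n_1 + \cdots + n_k$ be a partition of $n$ into positive integers (in the given order). Define $c_0 = 0$ and $c_i = n_1 + \cdots + n_i$ for $1 \le i \le k$. Then the matrix-vector product $Q_n x$ satisfies $$Q_n x = \begin{pmatrix} Q_{n_1}\, x_{1:c_1} \\ Q_{n_2}\, B_{c_2,c_1}\, x_{1:c_2} \\ \vdots \\ Q_{n_{k-1}}\, B_{c_{k-1},c_{k-2}}\, x_{1:c_{k-1}} \\ Q_{n_k}\, B_{c_k,c_{k-1}}\, x_{1:c_k} \end{pmatrix},$$ where $x_{1:c} \in \mathbb{R}^{c}$ denotes the vector consisting of the first $c$ entries of $x$.
   Context: Matrices are zero-indexed. The $\ell_\infty$-normalized lower triangular Pascal matrix $Q_n \in \mathbb{R}^{n\times n}$ has entries, for $0 \le i,j \le n-1$, $(Q_n)_{ij} = 2^{-i}\binom{i}{j}$ if $i \ge j$, and $(Q_n)_{ij} = 0$ otherwise. For $m \ge 0$, $b_m \in \mathbb{R}^{m+1}$ is the $\ell_1$-normalized binomial filter: $b_0 = 1$, $b_1 = (1/2,1/2)$, $b_m = b_{m-1} * b_1$ (discrete convolution) for $m>1$; equivalently $(b_m)_k = 2^{-m}\binom{m}{k}$ for $0 \le k \le m$. For $m < n$, $B_{n,m} \in \mathbb{R}^{(n-m)\times n}$ is the banded convolution matrix with entries $(B_{n,m})_{ij} = (b_m)_{j-i}$ if $0 \le j-i \le m$, and $0$ otherwise ($0 \le i < n-m$, $0 \le j < n$). *)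

theory Defs
  imports Complex_Main "Jordan_Normal_Form.Matrix"
begin

definition pascal_Q :: "nat \<Rightarrow> real mat" where
  "pascal_Q n = mat n n (\<lambda>(i, j). if j \<le> i then real (i choose j) / 2 ^ i else 0)"

text \<open>Full discrete convolution; both arguments are meant to be nonempty, the result then
  has dimension \<open>dim_vec u + dim_vec v - 1\<close>.\<close>

definition conv_vec :: "real vec \<Rightarrow> real vec \<Rightarrow> real vec" where
  "conv_vec u v = vec (dim_vec u + dim_vec v - 1)
     (\<lambda>k. \<Sum>i | i \<le> k \<and> i < dim_vec u \<and> k - i < dim_vec v. u $ i * v $ (k - i))"

fun binomial_filter :: "nat \<Rightarrow> real vec" where
  "binomial_filter 0 = vec_of_list [1]"
| "binomial_filter (Suc 0) = vec_of_list [1/2, 1/2]"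
| "binomial_filter (Suc (Suc m)) = conv_vec (binomial_filter (Suc m)) (binomial_filter 1)"

text \<open>Meant for \<open>m < n\<close>: the row dimension uses truncated subtraction.\<close>

definition conv_B :: "nat \<Rightarrow> nat \<Rightarrow> real mat" where
  "conv_B n m = mat (n - m) n
     (\<lambda>(i, j). if i \<le> j \<and> j - i \<le> m then binomial_filter m $ (j - i) else 0)"

definition concat_vec :: "'a vec list \<Rightarrow> 'a vec" where
  "concat_vec vs = foldr (@\<^sub>v) vs vNil"

lemma binomial_filter_closed_form:
  "binomial_filter m = vec (m + 1) (\<lambda>k. real (m choose k) / 2 ^ m)"
proof (induction m rule: binomial_filter.induct)
  case 1
  show ?case by (intro eq_vecI) auto
next
  case 2
  show ?case by (intro eq_vecI) (auto simp: less_Suc_eq numeral_2_eq_2)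
next
  case (3 m)
  have d: "dim_vec (binomial_filter (Suc m)) = m + 2" using 3 by simp
  show ?case
  proof (intro eq_vecI)
    show "dim_vec (binomial_filter (Suc (Suc m)))
        = dim_vec (vec (Suc (Suc m) + 1) (\<lambda>k. real (Suc (Suc m) choose k) / 2 ^ Suc (Suc m)))"
      using d by (simp add: conv_vec_def)
  next
    fix k assume "k < dim_vec (vec (Suc (Suc m) + 1) (\<lambda>k. real (Suc (Suc m) choose k) / 2 ^ Suc (Suc m)))"
    then have k: "k < m + 3" by simp
    let ?S = "{i. i \<le> k \<and> i < m + 2 \<and> k - i < 2}"
    let ?u = "binomial_filter (Suc m)"
    have e: "binomial_filter (Suc (Suc m)) $ k
        = (\<Sum>i\<in>?S. ?u $ i * vec_of_list [1/2, 1/2] $ (k - i))"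
      using k d by (simp add: conv_vec_def numeral_2_eq_2)
    have u: "?u $ i = real (Suc m choose i) / 2 ^ Suc m" if "i < m + 2" for i
      using 3 that by simp
    have "binomial_filter (Suc (Suc m)) $ k = real (Suc (Suc m) choose k) / 2 ^ Suc (Suc m)"
    proof (cases k)
      case 0
      then have "?S = {0}" by auto
      with 0 e u[of 0] show ?thesis by (simp add: vec_of_list_index)
    next
      case (Suc l)
      show ?thesis
      proof (cases "k < m + 2")
        case True
        then have "?S = {l, Suc l}" using Suc by auto
        with Suc e have "binomial_filter (Suc (Suc m)) $ k = ?u $ l / 2 + ?u $ k / 2"
          by (simp add: vec_of_list_index)
        also have "\<dots> = real (Suc m choose l) / 2 ^ Suc m / 2 + real (Suc m choose k) / 2 ^ Suc m / 2"
          using u[of l] u[of k] True Suc by simp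
        also have "\<dots> = real (Suc (Suc m) choose k) / 2 ^ Suc (Suc m)"
          by (simp add: Suc add_divide_distrib)
        finally show ?thesis .
      next
        case False
        then have "k = m + 2" "l = m + 1" using k Suc by auto
        then have "?S = {l}" by auto
        with e u[of l] \<open>k = m + 2\<close> \<open>l = m + 1\<close> show ?thesis
          by (simp add: vec_of_list_index)
      qed
    qed
    then show "binomial_filter (Suc (Suc m)) $ k
        = vec (Suc (Suc m) + 1) (\<lambda>k. real (Suc (Suc m) choose k) / 2 ^ Suc (Suc m)) $ k"
      using k by simp
  qed
qed

end

theory Submission
  imports Defs
begin

text \<open>The row \<open>m + p\<close> of the Pascal matrix applies the filter \<open>b\<^bsub>m+p\<^esub> = b\<^sub>p * b\<^sub>m\<close>: filtering first
  with \<open>b\<^sub>m\<close> (the matrix \<open>B\<close>) and then with \<open>b\<^sub>p\<close> (the row \<open>p\<close> of a small Pascal matrix) gives the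
  same entry. So each block is a segment of the full product.\<close>

text \<open>Pascal's rule splits each coefficient; the part with the lower index
  \<open>r - 1\<close> becomes the sum over the shifted sequence.\<close>

lemma binomial_sum_Suc:
  fixes g :: "nat \<Rightarrow> real"
  shows "(\<Sum>r\<le>Suc p. real (Suc p choose r) * g r) =
    (\<Sum>r\<le>p. real (p choose r) * g r) + (\<Sum>r\<le>p. real (p choose r) * g (Suc r))"
proof -
  have "(\<Sum>r\<le>p. real (p choose Suc r) * g (Suc r)) + real (p choose 0) * g 0 =
      (\<Sum>r\<le>Suc p. real (p choose r) * g r)"
    by (simp only: sum.atMost_Suc_shift add.commute)
  \<comment> \<open>The top term drops out because \<open>p choose Suc p\<close> is 0.\<close>
  also have "\<dots> = (\<Sum>r\<le>p. real (p choose r) * g r)"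
    by simp
  finally show ?thesis
    by (simp add: sum.atMost_Suc_shift distrib_right sum.distrib del: sum.atMost_Suc)
qed

text \<open>With E the shift of sequences, a binomial sum of order p is the value of (1 + E)^p g at
  0, so this is (1 + E)^p (1 + E)^m = (1 + E)^(p + m). \<open>g\<close> stays arbitrary in the
  induction since the step also needs the shifted sequence.\<close>

lemma binomial_sum_compose:
  fixes g :: "nat \<Rightarrow> real"
  shows "(\<Sum>j\<le>p. real (p choose j) * (\<Sum>l\<le>m. real (m choose l) * g (j + l))) =
    (\<Sum>r\<le>p + m. real (p + m choose r) * g r)"
proof (induction p arbitrary: g)
  case 0
  show ?case by simp
next
  case (Suc p)
  show ?case
    using Suc.IH[of g] Suc.IH[of "\<lambda>r. g (Suc r)"]
    by (simp only: binomial_sum_Suc add_Suc)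
qed

lemma dim_pascal_Q [simp]: "dim_row (pascal_Q n) = n" "dim_col (pascal_Q n) = n"
  by (simp_all add: pascal_Q_def)

lemma dim_conv_B [simp]: "dim_row (conv_B n m) = n - m" "dim_col (conv_B n m) = n"
  by (simp_all add: conv_B_def)

text \<open>Lower triangularity cuts the row off at \<open>p\<close>, so the right-hand side does
  not depend on \<open>n\<close>: rows of Pascal matrices of different sizes become
  comparable.\<close>

lemma pascal_Q_mult_index:
  assumes "p < n" "dim_vec v = n"
  shows "(pascal_Q n *\<^sub>v v) $ p = (\<Sum>j\<le>p. real (p choose j) * v $ j) / 2 ^ p"
proof -
  have "(pascal_Q n *\<^sub>v v) $ p =
      (\<Sum>j\<in>{0..<n}. if j \<le> p then real (p choose j) / 2 ^ p * v $ j else 0)"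
    using assms by (auto simp: pascal_Q_def scalar_prod_def intro!: sum.cong)
  also have "\<dots> = (\<Sum>j\<le>p. real (p choose j) / 2 ^ p * v $ j)"
    using assms by (intro sum.mono_neutral_cong_right) auto
  finally show ?thesis
    by (simp add: sum_divide_distrib)
qed

lemma conv_B_mult_index:
  assumes "j < n - m" "dim_vec v = n"
  shows "(conv_B n m *\<^sub>v v) $ j = (\<Sum>l\<le>m. real (m choose l) * v $ (j + l)) / 2 ^ m"
proof -
  have "(conv_B n m *\<^sub>v v) $ j =
      (\<Sum>i\<in>{0..<n}. if j \<le> i \<and> i - j \<le> m then real (m choose (i - j)) / 2 ^ m * v $ i else 0)"
    using assms
    by (auto simp: conv_B_def scalar_prod_def binomial_filter_closed_form intro!: sum.cong)
  \<comment> \<open>Since \<open>j < n - m\<close>, the band ends at \<open>j + m < n\<close> and is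
    never truncated.\<close>
  also have "\<dots> = (\<Sum>i\<in>{j..j + m}. real (m choose (i - j)) / 2 ^ m * v $ i)"
    using assms by (intro sum.mono_neutral_cong_right) auto
  also have "\<dots> = (\<Sum>l\<le>m. real (m choose l) / 2 ^ m * v $ (j + l))"
    by (rule sum.reindex_bij_witness[of _ "\<lambda>l. j + l" "\<lambda>i. i - j"]) auto
  finally show ?thesis
    by (simp add: sum_divide_distrib)
qed

lemma pascal_Q_conv_B_index:
  assumes "p < n - m" "dim_vec v = n"
  shows "(pascal_Q (n - m) *\<^sub>v (conv_B n m *\<^sub>v v)) $ p = (pascal_Q n *\<^sub>v v) $ (m + p)"
proof -
  have "(pascal_Q (n - m) *\<^sub>v (conv_B n m *\<^sub>v v)) $ p =
      (\<Sum>j\<le>p. real (p choose j) * (conv_B n m *\<^sub>v v) $ j) / 2 ^ p"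
    using assms by (intro pascal_Q_mult_index) auto
  also have "\<dots> = (\<Sum>j\<le>p. real (p choose j) * (\<Sum>l\<le>m. real (m choose l) * v $ (j + l))) / 2 ^ m / 2 ^ p"
    using assms
    by (simp add: conv_B_mult_index sum_divide_distrib sum_distrib_left del: index_mult_mat_vec)
  also have "\<dots> = (\<Sum>r\<le>p + m. real (p + m choose r) * v $ r) / 2 ^ (p + m)"
    by (simp add: binomial_sum_compose power_add mult.commute)
  also have "\<dots> = (pascal_Q n *\<^sub>v v) $ (p + m)"
    using assms by (intro pascal_Q_mult_index[symmetric]) auto
  finally show ?thesis by (simp only: add.commute)
qed

lemma conv_B_0_mult:
  assumes "dim_vec v = n"
  shows "conv_B n 0 *\<^sub>v v = v"
  using assms by (intro eq_vecI) (auto simp: conv_B_mult_index simp del: index_mult_mat_vec)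

lemma pascal_Q_vec_first_index:
  assumes "p < c" "c \<le> dim_vec x"
  shows "(pascal_Q c *\<^sub>v vec_first x c) $ p = (pascal_Q (dim_vec x) *\<^sub>v x) $ p"
  using assms
  by (auto simp: pascal_Q_mult_index vec_first_def simp del: index_mult_mat_vec intro!: sum.cong)

text \<open>The lengths telescope. Monotonicity is carried along in the conclusion because the
  truncated differences add up only when \<open>c (Suc a) \<le> c b\<close>.\<close>

lemma concat_vec_segments:
  fixes f :: "nat \<Rightarrow> 'a"
  assumes "a \<le> b" "\<And>i. a \<le> i \<Longrightarrow> i < b \<Longrightarrow> c i \<le> c (Suc i)"
  shows "c a \<le> c b \<and>
    concat_vec (map (\<lambda>i. vec (c (Suc i) - c i) (\<lambda>p. f (c i + p))) [a..<b]) =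
      vec (c b - c a) (\<lambda>p. f (c a + p))"
  using assms
proof (induction a rule: inc_induct)
  case base
  show ?case by (auto simp: concat_vec_def)
next
  case (step a)
  have le: "c a \<le> c (Suc a)" "c (Suc a) \<le> c b"
    and IH: "concat_vec (map (\<lambda>i. vec (c (Suc i) - c i) (\<lambda>p. f (c i + p))) [Suc a..<b]) =
      vec (c b - c (Suc a)) (\<lambda>p. f (c (Suc a) + p))"
    using step by auto
  have "vec (c (Suc a) - c a) (\<lambda>p. f (c a + p)) @\<^sub>v
      vec (c b - c (Suc a)) (\<lambda>p. f (c (Suc a) + p)) = vec (c b - c a) (\<lambda>p. f (c a + p))"
    using le by (intro eq_vecI) (auto simp: add.commute)
  moreover have "[a..<b] = a # [Suc a..<b]"
    using step.hyps by (simp add: upt_conv_Cons)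
  ultimately show ?case
    using le IH by (simp add: concat_vec_def)
qed

theorem mainTheorem2:
  fixes n k :: nat and x :: "real vec" and ns c :: "nat \<Rightarrow> nat"
  assumes "n > 0" and "k > 0"
    and "x \<in> carrier_vec n"
    and "\<And>i. 1 \<le> i \<Longrightarrow> i \<le> k \<Longrightarrow> ns i > 0"
    and "n = (\<Sum>i = 1..k. ns i)"
    and "c 0 = 0"
    and "\<And>i. 1 \<le> i \<Longrightarrow> i \<le> k \<Longrightarrow> c i = (\<Sum>j = 1..i. ns j)"
  shows "pascal_Q n *\<^sub>v x =
    concat_vec
      ((pascal_Q (ns 1) *\<^sub>v vec_first x (c 1)) #
       map (\<lambda>i. pascal_Q (ns i) *\<^sub>v (conv_B (c i) (c (i - 1)) *\<^sub>v vec_first x (c i)))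
         [2..<k + 1])"
proof -
  let ?f = "\<lambda>r. (pascal_Q n *\<^sub>v x) $ r"
  let ?block = "\<lambda>i. pascal_Q (ns i) *\<^sub>v (conv_B (c i) (c (i - 1)) *\<^sub>v vec_first x (c i))"
  have dim_x: "dim_vec x = n"
    using assms(3) by simp
  have c_Suc: "c (Suc i) = c i + ns (Suc i)" if "i < k" for i
    using that assms(6,7) by (cases i) auto
  have c_k: "c k = n"
    using assms(2,5,7) by simp
  \<comment> \<open>Only the monotonicity half of the lemma matters here; the function is a
    dummy.\<close>
  have c_le: "c i \<le> n" if "i \<le> k" for i
    using concat_vec_segments[of i k c "\<lambda>r. r"] that c_Suc c_k by simp
  have block: "?block (Suc i) = vec (c (Suc i) - c i) (\<lambda>p. ?f (c i + p))" if "i < k" for i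
  proof (intro eq_vecI)
    fix p
    assume "p < dim_vec (vec (c (Suc i) - c i) (\<lambda>p. ?f (c i + p)))"
    then have p: "p < c (Suc i) - c i" by simp
    \<comment> \<open>The block size \<open>ns (Suc i)\<close> is \<open>c (Suc i) - c i\<close>, so
      the filter identity applies with size \<open>c (Suc i)\<close> and filter order
      \<open>c i\<close>.\<close>
    have "?block (Suc i) $ p = (pascal_Q (c (Suc i)) *\<^sub>v vec_first x (c (Suc i))) $ (c i + p)"
      using pascal_Q_conv_B_index[OF p, of "vec_first x (c (Suc i))"] c_Suc[OF that] by simp
    also have "\<dots> = ?f (c i + p)"
      using p that c_le[of "Suc i"] dim_x
      by (subst pascal_Q_vec_first_index) auto
    finally show "?block (Suc i) $ p = vec (c (Suc i) - c i) (\<lambda>p. ?f (c i + p)) $ p"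
      using p by simp
  qed (use c_Suc[OF that] in simp)
  \<comment> \<open>The first block has no filter factor, but \<open>c 0 = 0\<close> makes that
    factor the identity, so it is the case \<open>i = 1\<close> of \<open>?block\<close>.\<close>
  have "[1..<k + 1] = 1 # [2..<k + 1]"
    using assms(2) upt_conv_Cons[of 1 "k + 1"] by (simp only: one_add_one Suc_eq_plus1)
  then have "(pascal_Q (ns 1) *\<^sub>v vec_first x (c 1)) # map ?block [2..<k + 1] = map ?block [1..<k + 1]"
    using assms(6) by (simp only: list.map diff_self_eq_0 conv_B_0_mult dim_vec_first)
  also have "\<dots> = map (\<lambda>i. ?block (Suc i)) [0..<k]"
    by (simp add: map_Suc_upt[symmetric] comp_def del: upt_Suc)
  also have "\<dots> = map (\<lambda>i. vec (c (Suc i) - c i) (\<lambda>p. ?f (c i + p))) [0..<k]"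
    using block by (intro map_cong) auto
  finally have "concat_vec ((pascal_Q (ns 1) *\<^sub>v vec_first x (c 1)) # map ?block [2..<k + 1]) =
      vec n ?f"
    using concat_vec_segments[of 0 k c ?f] c_Suc c_k assms(6) by simp
  also have "\<dots> = pascal_Q n *\<^sub>v x"
    by (intro eq_vecI) auto
  finally show ?thesis ..
qed

end
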